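(* The DAGs returned by the algorithm $\mathrm{DPLL}_o$ (exhaustive DPLL with fixed variable ordering, defined in the context), over all input CNF formulas and all variable orders, form exactly the language of reduced OBDDs. That is: (i) for every CNF formula $\Delta$ and every variable order $\pi$, the DAG returned by $\mathrm{DPLL}_o(\Delta,\pi)$ is a reduced OBDD; and (ii) for every reduced OBDD $G$ there exist a CNF formula $\Delta$ and a variable order $\pi$ such that the DAG returned by $\mathrm{DPLL}_o(\Delta,\pi)$ is isomorphic to $G$ (by an isomorphism preserving labels and the low/high distinction of children).
   Context: Fix a countably infinite set of propositional variables. A literal is $x$ or $\neg x$ for a variable $x$; a clause is a finite set (disjunction) of literals, possibly empty; a CNF formula is a finite set (conjunction) of clauses. The variables of $\Delta$ are those occurring in its clauses. For $b\in\{0,1\}$, $\Delta|_{x=b}$ is the CNF formula obtained from $\Delta$ by replacing $x$ with $b$: every clause containing a literal that evaluates to $1$ is removed, and every literal that evaluates to $0$ is deleted from the remaining clauses. A variable order $\pi$ for $\Delta$ is a linear order (finite list without repetition) of variables including all variables of $\Delta$. **OBDD.** A decision diagram is a finite rooted DAG, all of whose nodes are reachable from the root, in which each node is either a sink labeled $0$ or $1$ (the 0-sink, the 1-sink) or a decision node labeled with a variable $x$ and having two designated children, a low child $\beta$ and a high child $\alpha$; such a node stands for the circuit $(x\wedge\alpha)\vee(\neg x\wedge\beta)$. An FBDD is a decision diagram in which every variable labels at most one node on any root-to-sink path. An OBDD (ordered binary decision diagram) is an FBDD in which variables appear in the same order on all root-to-sink paths, i.e. there is a linear order of variables such that along every root-to-sink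 path the labels of the decision nodes are strictly increasing. It is reduced if (a) there is at most one 0-sink and at most one 1-sink, and no two distinct decision nodes have the same label, the same low child and the same high child; and (b) no decision node has identical low and high children. **Algorithm $\mathrm{DPLL}_o(\Delta,\pi)$.** 1. If $\Delta$ contains the empty clause, return the 0-sink. 2. If there are no variables in $\Delta$, return the 1-sink. 3. Let $\mathit{key}=\text{compute-key}(\Delta)$. If the cache has an entry $(\mathit{key},\mathit{result})$, return $\mathit{result}$. 4. Let $x$ be the first variable in the order $\pi$ that appears in $\Delta$. 5. Let $\mathit{result}=\text{get-node}(x,\ \mathrm{DPLL}_o(\Delta|_{x=0},\pi),\ \mathrm{DPLL}_o(\Delta|_{x=1},\pi))$; insert $(\mathit{key},\mathit{result})$ into the cache; return $\mathit{result}$. The cache is initially empty and is shared by all recursive calls of an execution (with the same $\pi$). The function compute-key is any fixed function such that two CNF formulas receive equal keys only if they are logically equivalent (for example, equal keys only for identical sets of clauses). There is a single 0-sink and a single 1-sink. The function $\text{get-node}(x,\mathit{low},\mathit{high})$ uses a global table of nodes (the unique-nodes table, initially empty, shared by all recursive calls of an execution): if $\mathit{low}$ and $\mathit{high}$ are the same node, it returns that node; otherwise, if a decision node labeled $x$ with low child $\mathit{low}$ and high child $\mathit{high}$ is already in the table, it returns that node; otherwise it creates such a node, stores it in the table, and returns it. The DAG returned by an execution is the DAG of all nodes reachable from the returned node. *)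

theory Defs
  imports Main "HOL-Library.FSet"
begin

section \<open>CNF formulas\<close>

type_synonym variable = nat

datatype literal = Pos (var: variable) | Neg (var: variable)

type_synonym clause = "literal fset"

type_synonym cnf = "clause fset"

definition vars :: "cnf \<Rightarrow> variable set" where
  "vars \<Delta> = (\<Union>C\<in>fset \<Delta>. var ` fset C)"

fun literal_holds :: "(variable \<Rightarrow> bool) \<Rightarrow> literal \<Rightarrow> bool" where
  "literal_holds \<tau> (Pos x) \<longleftrightarrow> \<tau> x"
| "literal_holds \<tau> (Neg x) \<longleftrightarrow> \<not> \<tau> x"

definition cnf_holds :: "(variable \<Rightarrow> bool) \<Rightarrow> cnf \<Rightarrow> bool" where
  "cnf_holds \<tau> \<Delta> \<longleftrightarrow> (\<forall>C. C |\<in>| \<Delta> \<longrightarrow> (\<exists>l. l |\<in>| C \<and> literal_holds \<tau> l))"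

definition logically_equivalent :: "cnf \<Rightarrow> cnf \<Rightarrow> bool" where
  "logically_equivalent \<Delta> \<Delta>' \<longleftrightarrow> (\<forall>\<tau>. cnf_holds \<tau> \<Delta> \<longleftrightarrow> cnf_holds \<tau> \<Delta>')"

text \<open>The literal over \<open>x\<close> that evaluates to true when \<open>x\<close> is replaced with \<open>b\<close>.\<close>

definition literal_of :: "variable \<Rightarrow> bool \<Rightarrow> literal" where
  "literal_of x b = (if b then Pos x else Neg x)"

definition cond :: "variable \<Rightarrow> bool \<Rightarrow> cnf \<Rightarrow> cnf" where
  "cond x b \<Delta> =
    (\<lambda>C. C |-| {|literal_of x (\<not> b)|}) |`| ffilter (\<lambda>C. literal_of x b |\<notin>| C) \<Delta>"

definition variable_order :: "variable list \<Rightarrow> cnf \<Rightarrow> bool" where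
  "variable_order \<pi> \<Delta> \<longleftrightarrow> distinct \<pi> \<and> vars \<Delta> \<subseteq> set \<pi>"

lemma finite_vars [simp]: "finite (vars \<Delta>)"
  by (simp add: vars_def)

lemma vars_cond: "vars (cond x b \<Delta>) \<subseteq> vars \<Delta> - {x}"
proof
  fix y assume "y \<in> vars (cond x b \<Delta>)"
  then obtain C l where C: "C |\<in>| \<Delta>" "literal_of x b |\<notin>| C"
    and l: "l |\<in>| C" "l \<noteq> literal_of x (\<not> b)" "y = var l"
    by (auto simp: vars_def cond_def)
  from C l have "l \<noteq> literal_of x b" by auto
  with l have "y \<noteq> x" by (cases l; cases b) (auto simp: literal_of_def)
  with C l show "y \<in> vars \<Delta> - {x}" by (auto simp: vars_def)
qed


section \<open>Decision diagrams\<close>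

text \<open>\<open>Decision x l h\<close> is a decision node labeled \<open>x\<close> with low child \<open>l\<close> and high child \<open>h\<close>;
  the generated set function \<open>children\<close> yields \<open>{l, h}\<close>, and \<open>{}\<close> for a sink.\<close>

datatype (children: 'v) node = Sink bool | Decision variable 'v 'v

text \<open>The values of \<open>content\<close> outside \<open>nodes\<close> carry no meaning.\<close>

record 'v diagram =
  nodes :: "'v set"
  root :: 'v
  content :: "'v \<Rightarrow> 'v node"

definition edges :: "'v diagram \<Rightarrow> ('v \<times> 'v) set" where
  "edges G = {(u, v). u \<in> nodes G \<and> v \<in> children (content G u)}"

definition decision_diagram :: "'v diagram \<Rightarrow> bool" where
  "decision_diagram G \<longleftrightarrow>
    finite (nodes G) \<and> root G \<in> nodes G \<and>
    (\<forall>u\<in>nodes G. children (content G u) \<subseteq> nodes G) \<and>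
    acyclic (edges G) \<and>
    (\<forall>u\<in>nodes G. (root G, u) \<in> (edges G)\<^sup>*)"

definition root_sink_path :: "'v diagram \<Rightarrow> 'v list \<Rightarrow> bool" where
  "root_sink_path G p \<longleftrightarrow>
    p \<noteq> [] \<and> hd p = root G \<and> successively (\<lambda>u v. (u, v) \<in> edges G) p \<and>
    (\<exists>b. content G (last p) = Sink b)"

fun node_labels :: "'v node \<Rightarrow> variable list" where
  "node_labels (Sink b) = []"
| "node_labels (Decision x l h) = [x]"

definition path_labels :: "'v diagram \<Rightarrow> 'v list \<Rightarrow> variable list" where
  "path_labels G p = concat (map (\<lambda>u. node_labels (content G u)) p)"

definition fbdd :: "'v diagram \<Rightarrow> bool" where
  "fbdd G \<longleftrightarrow>
    decision_diagram G \<and> (\<forall>p. root_sink_path G p \<longrightarrow> distinct (path_labels G p))"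

definition obdd :: "'v diagram \<Rightarrow> bool" where
  "obdd G \<longleftrightarrow>
    fbdd G \<and>
    (\<exists>r :: variable rel. linear_order r \<and>
      (\<forall>p. root_sink_path G p \<longrightarrow>
        sorted_wrt (\<lambda>x y. (x, y) \<in> r \<and> x \<noteq> y) (path_labels G p)))"

definition reduced :: "'v diagram \<Rightarrow> bool" where
  "reduced G \<longleftrightarrow>
    (\<forall>u\<in>nodes G. \<forall>v\<in>nodes G. \<forall>b.
      content G u = Sink b \<and> content G v = Sink b \<longrightarrow> u = v) \<and>
    (\<forall>u\<in>nodes G. \<forall>v\<in>nodes G. \<forall>x l h.
      content G u = Decision x l h \<and> content G v = Decision x l h \<longrightarrow> u = v) \<and>
    (\<forall>u\<in>nodes G. \<forall>x l h. content G u = Decision x l h \<longrightarrow> l \<noteq> h)"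

definition reduced_obdd :: "'v diagram \<Rightarrow> bool" where
  "reduced_obdd G \<longleftrightarrow> obdd G \<and> reduced G"

definition isomorphic :: "'v diagram \<Rightarrow> 'w diagram \<Rightarrow> bool" where
  "isomorphic G H \<longleftrightarrow>
    (\<exists>f. bij_betw f (nodes G) (nodes H) \<and> f (root G) = root H \<and>
      (\<forall>u\<in>nodes G. content H (f u) = map_node f (content G u)))"


section \<open>Exhaustive DPLL with a fixed variable order\<close>

text \<open>A node is referred to either as one of the two sinks or by its position in the
  unique-nodes table. The table lists the triples (label, low child, high child) of the decision
  nodes in order of creation.\<close>

datatype node_ref = Sink_ref bool | Entry nat

type_synonym unique_table = "(variable \<times> node_ref \<times> node_ref) list"

type_synonym 'k cache = "'k \<rightharpoonup> node_ref"

definition get_node ::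
    "variable \<Rightarrow> node_ref \<Rightarrow> node_ref \<Rightarrow> unique_table \<Rightarrow> node_ref \<times> unique_table" where
  "get_node x low high T =
    (if low = high then (low, T)
     else if (x, low, high) \<in> set T
       then (Entry (LEAST i. i < length T \<and> T ! i = (x, low, high)), T)
     else (Entry (length T), T @ [(x, low, high)]))"

definition valid_key :: "(cnf \<Rightarrow> 'k) \<Rightarrow> bool" where
  "valid_key key \<longleftrightarrow> (\<forall>\<Delta> \<Delta>'. key \<Delta> = key \<Delta>' \<longrightarrow> logically_equivalent \<Delta> \<Delta>')"

text \<open>The call on \<open>cond x False \<Delta>\<close> is executed before the one on \<open>cond x True \<Delta>\<close>, with cache and
  table passed along. The result \<open>undefined\<close> is reached only if \<open>\<pi>\<close> lacks variables of \<open>\<Delta>\<close>.\<close>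

function dpll ::
    "(cnf \<Rightarrow> 'k) \<Rightarrow> variable list \<Rightarrow> cnf \<Rightarrow> 'k cache \<times> unique_table
      \<Rightarrow> node_ref \<times> 'k cache \<times> unique_table" where
  "dpll key \<pi> \<Delta> (cache, T) =
    (if {||} |\<in>| \<Delta> then (Sink_ref False, cache, T)
     else if vars \<Delta> = {} then (Sink_ref True, cache, T)
     else case cache (key \<Delta>) of
       Some result \<Rightarrow> (result, cache, T)
     | None \<Rightarrow>
        (case find (\<lambda>x. x \<in> vars \<Delta>) \<pi> of
           None \<Rightarrow> undefined
         | Some x \<Rightarrow>
            (let (low, state0) = dpll key \<pi> (cond x False \<Delta>) (cache, T);
                 (high, cache1, T1) = dpll key \<pi> (cond x True \<Delta>) state0;
                 (result, T2) = get_node x low high T1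
             in (result, cache1(key \<Delta> \<mapsto> result), T2))))"
  by pat_completeness auto
termination
proof (relation "measure (\<lambda>(key, \<pi>, \<Delta>, state). card (vars \<Delta>))", goal_cases)
  case 1
  show ?case by simp
next
  case (2 key \<pi> \<Delta> cache T x)
  then have "x \<in> vars \<Delta>" by (auto simp: find_Some_iff)
  then have "vars (cond x False \<Delta>) \<subset> vars \<Delta>" using vars_cond by blast
  then show ?case by (simp add: psubset_card_mono)
next
  case (3 key \<pi> \<Delta> cache T x)
  then have "x \<in> vars \<Delta>" by (auto simp: find_Some_iff)
  then have "vars (cond x True \<Delta>) \<subset> vars \<Delta>" using vars_cond by blast
  then show ?case by (simp add: psubset_card_mono)
qed

fun ref_content :: "unique_table \<Rightarrow> node_ref \<Rightarrow> node_ref node" where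
  "ref_content T (Sink_ref b) = Sink b"
| "ref_content T (Entry i) = (case T ! i of (x, low, high) \<Rightarrow> Decision x low high)"

definition reachable_diagram :: "unique_table \<Rightarrow> node_ref \<Rightarrow> node_ref diagram" where
  "reachable_diagram T r =
    \<lparr>nodes = {u. (r, u) \<in> {(u, v). v \<in> children (ref_content T u)}\<^sup>*},
     root = r, content = ref_content T\<rparr>"

definition dpll_diagram :: "(cnf \<Rightarrow> 'k) \<Rightarrow> cnf \<Rightarrow> variable list \<Rightarrow> node_ref diagram" where
  "dpll_diagram key \<Delta> \<pi> =
    (case dpll key \<pi> \<Delta> (Map.empty, []) of (r, _, T) \<Rightarrow> reachable_diagram T r)"

end

theory Submission imports Defs begin

text \<open>A node of a decision diagram unfolds to a binary tree. Ordered trees without redundant tests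
  are determined by the Boolean function they compute; a reduced OBDD is determined up to isomorphism
  by the unfolding of its root. The algorithm keeps the invariant that each cached reference
  unfolds to the canonical tree of the formula it is cached for, so \<open>DPLL\<^sub>o\<close> returns a reduced OBDD
  of its input. Conversely, the tree of a reduced OBDD can be written as a CNF formula over its
  labels, and on this formula the algorithm must reproduce the tree.\<close>

text \<open>A cache hit may return a node that was built for a different formula, since equal keys
  promise only logical equivalence. A reference is therefore tied to a formula only through the
  function that its tree computes. The second obstacle is that \<open>get_node\<close> compares
  children by identity, while redundancy is a matter of functions. Keeping the table entries
  distinct bridges the gap: different references then have different trees. Trees may be
  exponentially larger than the diagrams that share their subtrees, but they occur only in the
  proof, where structural induction on them replaces induction over DAGs.\<close>

section \<open>Ordered binary trees and their canonicity\<close>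

datatype (labels: 'a) bdd = Leaf bool | Branch 'a "'a bdd" "'a bdd"

fun eval_bdd :: "('a \<Rightarrow> bool) \<Rightarrow> 'a bdd \<Rightarrow> bool" where
  "eval_bdd \<tau> (Leaf b) \<longleftrightarrow> b"
| "eval_bdd \<tau> (Branch x l h) \<longleftrightarrow> eval_bdd \<tau> (if \<tau> x then h else l)"

fun robdd :: "'a rel \<Rightarrow> 'a bdd \<Rightarrow> bool" where
  "robdd r (Leaf b) \<longleftrightarrow> True"
| "robdd r (Branch x l h) \<longleftrightarrow> l \<noteq> h \<and> (\<forall>y\<in>labels l \<union> labels h. (x, y) \<in> r \<and> x \<noteq> y) \<and>
    robdd r l \<and> robdd r h"

lemma finite_labels [simp]: "finite (labels t)"
  by (induction t) auto

lemma eval_bdd_upd [simp]: "x \<notin> labels t \<Longrightarrow> eval_bdd (\<tau>(x := b)) t = eval_bdd \<tau> t"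
  by (induction t) auto

text \<open>This extracts a cofactor from the function of the whole tree; since \<open>x\<close>
  does not occur below the root, the update of \<tau> does not reach the chosen branch.\<close>

lemma eval_Branch_upd:
  "x \<notin> labels l \<union> labels h \<Longrightarrow>
    eval_bdd (\<tau>(x := b)) (Branch x l h) = eval_bdd \<tau> (if b then h else l)"
  by simp

lemma robdd_Branch_fresh: "robdd r (Branch x l h) \<Longrightarrow> x \<notin> labels l \<union> labels h"
  by auto

text \<open>If the roots carry the same label, the cofactors agree and induction applies to each
  branch. Otherwise one root label is absent from the other tree, so the common function ignores it
  and that root tests it in vain. The induction is on the joint size because the second situation
  compares two branches of one tree rather than a branch of each.\<close>

lemma robdd_unique:
  assumes "linear_order r" "robdd r t" "robdd r t'"
    "\<And>\<tau>. eval_bdd \<tau> t = eval_bdd \<tau> t'"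
  shows "t = t'"
  using assms(2,3,4)
proof (induction "size t + size t'" arbitrary: t t' rule: less_induct)
  case less
  \<comment> \<open>Setting \<open>x\<close> either way leaves the value of \<open>s\<close>
    unchanged, so \<open>l\<close> and \<open>h\<close> compute the same function; by induction they
    are equal, which \<open>robdd\<close> forbids.\<close>
  have redundant: False
    if eq: "\<And>\<tau>. eval_bdd \<tau> (Branch x l h) = eval_bdd \<tau> s" and x: "x \<notin> labels s"
      and r: "robdd r (Branch x l h)" and sz: "size l + size h < size t + size t'"
    for x l h s
  proof -
    have "eval_bdd \<tau> l = eval_bdd \<tau> h" for \<tau>
      using eq[of "\<tau>(x := False)"] eq[of "\<tau>(x := True)"] x robdd_Branch_fresh[OF r]
      by (simp only: eval_Branch_upd eval_bdd_upd if_True if_False simp_thms not_False_eq_True)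
    then have "l = h" using less.hyps[OF sz] r by simp
    then show False using r by simp
  qed
  show ?case
  proof (cases t)
    case (Leaf b)
    then show ?thesis
    proof (cases t')
      case (Branch y l' h')
      then show ?thesis using redundant[of y l' h' t] Leaf less.prems by simp
    qed (use less.prems in simp)
  next
    case t: (Branch x l h)
    show ?thesis
    proof (cases t')
      case (Leaf b)
      then show ?thesis using redundant[of x l h t'] t less.prems by simp
    next
      case t': (Branch y l' h')
      have po: "trans r" "antisym r" "total r"
        using assms(1) by (auto simp: linear_order_on_def partial_order_on_def preorder_on_def)
      consider "x = y" | "x \<noteq> y" "(x, y) \<in> r" | "x \<noteq> y" "(y, x) \<in> r"
        using po(3) by (auto simp: total_on_def)
      then show ?thesis
      proof cases
        case 1
        have fresh: "x \<notin> labels l \<union> labels h" "x \<notin> labels l' \<union> labels h'"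
          using less.prems(1,2) 1 unfolding t t' by auto
        have ev: "eval_bdd \<tau> (if b then h else l) = eval_bdd \<tau> (if b then h' else l')" for \<tau> b
          using less.prems(3)[of "\<tau>(x := b)"] fresh unfolding t t' 1
          by (simp only: eval_Branch_upd simp_thms not_False_eq_True)
        have "l = l'" using less.hyps[of l l'] ev[of _ False] less.prems t t' by simp
        moreover have "h = h'" using less.hyps[of h h'] ev[of _ True] less.prems t t' by simp
        ultimately show ?thesis using 1 t t' by simp
      next
        case 2
        \<comment> \<open>Every label of \<open>t'\<close> is \<open>y\<close> or lies strictly
          above \<open>y\<close>, so antisymmetry excludes the smaller label
          \<open>x\<close>.\<close>
        then have "x \<notin> labels t'"
          using less.prems(2) po unfolding t' by (auto dest: antisymD)
        then show ?thesis using redundant[of x l h t'] t less.prems by simp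
      next
        case 3
        then have "y \<notin> labels t"
          using less.prems(1) po unfolding t by (auto dest: antisymD)
        then show ?thesis using redundant[of y l' h' t] t' less.prems by simp
      qed
    qed
  qed
qed

text \<open>At a node labeled \<open>x\<close> the two branches differ, hence by canonicity their
  functions differ. This later confines the labels of a tree to the variables of a formula that it
  represents.\<close>

lemma robdd_label_essential:
  assumes "linear_order r" "robdd r t" "x \<in> labels t"
  shows "\<exists>\<tau>. eval_bdd (\<tau>(x := True)) t \<noteq> eval_bdd (\<tau>(x := False)) t"
  using assms(2,3)
proof (induction t)
  case (Branch y l h)
  have fresh: "y \<notin> labels l" "y \<notin> labels h"
    using Branch.prems(1) robdd_Branch_fresh by fast+
  \<comment> \<open>Setting \<open>y\<close> to \<open>b\<close> steers the evaluation into the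
    branch \<open>s\<close> without affecting \<open>s\<close>.\<close>
  have lift: "\<exists>\<tau>. eval_bdd (\<tau>(x := True)) (Branch y l h) \<noteq> eval_bdd (\<tau>(x := False)) (Branch y l h)"
    if "x \<noteq> y" "eval_bdd (\<tau>(x := True)) s \<noteq> eval_bdd (\<tau>(x := False)) s" "s = (if b then h else l)"
    for \<tau> s b
    using that fresh
    by (intro exI[of _ "\<tau>(y := b)"]) (auto simp: fun_upd_twist[of y x])
  consider "x = y" | "x \<noteq> y" "x \<in> labels l" | "x \<noteq> y" "x \<in> labels h"
    using Branch.prems by auto
  then show ?case
  proof cases
    case 1
    obtain \<tau> where "eval_bdd \<tau> l \<noteq> eval_bdd \<tau> h"
      using robdd_unique[OF assms(1), of l h] Branch.prems(1) by auto
    moreover have "eval_bdd (\<tau>(x := b)) (Branch y l h) = eval_bdd \<tau> (if b then h else l)" for b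
      using eval_Branch_upd[of y l h] fresh 1 by simp
    ultimately show ?thesis using 1 by (intro exI[of _ \<tau>]) (simp only: if_True if_False)
  next
    case 2
    obtain \<tau> where "eval_bdd (\<tau>(x := True)) l \<noteq> eval_bdd (\<tau>(x := False)) l"
      using Branch.IH(1) Branch.prems(1) 2(2) by fastforce
    then show ?thesis using 2(1) by (intro lift[of \<tau> l False]) simp_all
  next
    case 3
    obtain \<tau> where "eval_bdd (\<tau>(x := True)) h \<noteq> eval_bdd (\<tau>(x := False)) h"
      using Branch.IH(2) Branch.prems(1) 3(2) by fastforce
    then show ?thesis using 3(1) by (intro lift[of \<tau> h True]) simp_all
  qed
qed simp


section \<open>Unfolding a diagram into a tree\<close>

text \<open>A relation rather than a function, because an arbitrary content function may have
  cycles, where no finite tree exists.\<close>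

inductive unfolds :: "('v \<Rightarrow> 'v node) \<Rightarrow> 'v \<Rightarrow> variable bdd \<Rightarrow> bool" for c where
  unfolds_Sink: "c u = Sink b \<Longrightarrow> unfolds c u (Leaf b)"
| unfolds_Decision: "c u = Decision x l h \<Longrightarrow> unfolds c l lo \<Longrightarrow> unfolds c h hi \<Longrightarrow>
    unfolds c u (Branch x lo hi)"

inductive_cases unfolds_LeafE: "unfolds c u (Leaf b)"
inductive_cases unfolds_BranchE: "unfolds c u (Branch x lo hi)"

text \<open>The size of the unfolding is a rank that decreases along edges; it later yields
  acyclicity of the returned diagram.\<close>

lemma unfolds_children:
  assumes "unfolds c u t" "v \<in> children (c u)"
  obtains s where "unfolds c v s" "size s < size t"
  using assms by (cases rule: unfolds.cases) auto

lemma unfolds_deterministic: "unfolds c u t \<Longrightarrow> unfolds c u t' \<Longrightarrow> t = t'"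
proof (induction arbitrary: t' rule: unfolds.induct)
  case (unfolds_Sink u b)
  from this(2) show ?case by (cases rule: unfolds.cases) (simp_all add: unfolds_Sink(1))
next
  case (unfolds_Decision u x l h lo hi)
  from unfolds_Decision.prems obtain lo' hi'
    where "t' = Branch x lo' hi'" "unfolds c l lo'" "unfolds c h hi'"
    by (cases rule: unfolds.cases) (simp_all add: unfolds_Decision.hyps(1))
  then show ?case using unfolds_Decision.IH by blast
qed

section \<open>Reduced diagrams are determined by the tree of their root\<close>

lemma decision_diagramD:
  assumes "decision_diagram G"
  shows "finite (nodes G)" "root G \<in> nodes G" "acyclic (edges G)"
    "u \<in> nodes G \<Longrightarrow> (root G, u) \<in> (edges G)\<^sup>*"
  using assms by (simp_all add: decision_diagram_def)

lemma edgesD: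
  assumes "decision_diagram G" "(u, v) \<in> edges G"
  shows "u \<in> nodes G" "v \<in> nodes G" "v \<in> children (content G u)"
proof -
  show uv: "u \<in> nodes G" "v \<in> children (content G u)" using assms(2) by (simp_all add: edges_def)
  have "\<forall>u\<in>nodes G. children (content G u) \<subseteq> nodes G"
    using assms(1) unfolding decision_diagram_def by blast
  then show "v \<in> nodes G" using uv by blast
qed

lemma children_in_nodes:
  assumes "decision_diagram G" "u \<in> nodes G" "content G u = Decision x l h"
  shows "l \<in> nodes G" "h \<in> nodes G"
  using edgesD(2)[OF assms(1), of u] assms(2,3) by (simp_all add: edges_def)

lemma unfolds_exists:
  assumes G: "decision_diagram G" and "u \<in> nodes G"
  shows "\<exists>t. unfolds (content G) u t"
proof -
  have "edges G \<subseteq> nodes G \<times> nodes G" by (auto dest: edgesD[OF G])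
  then have "finite (edges G)"
    using decision_diagramD(1)[OF G] by (simp add: finite_subset)
  then have "wf ((edges G)\<inverse>)"
    using decision_diagramD(3)[OF G] by (simp add: finite_acyclic_wf_converse)
  then show ?thesis using assms(2)
  proof (induction u rule: wf_induct_rule)
    case (less u)
    show ?case
    proof (cases "content G u")
      case (Sink b)
      then show ?thesis using unfolds_Sink[of "content G", OF Sink] by blast
    next
      case (Decision x l h)
      then have "l \<in> nodes G" "h \<in> nodes G" "(l, u) \<in> (edges G)\<inverse>" "(h, u) \<in> (edges G)\<inverse>"
        using less.prems children_in_nodes[OF G less.prems Decision] by (simp_all add: edges_def)
      then obtain lo hi where "unfolds (content G) l lo" "unfolds (content G) h hi"
        using less.IH[of l] less.IH[of h] by blast
      then show ?thesis using unfolds_Decision[of "content G", OF Decision] by blast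
    qed
  qed
qed

text \<open>Bottom-up merging: once the children of two nodes with the same tree coincide, the nodes
  carry the same triple, and reducedness identifies them.\<close>

lemma unfolds_injective:
  assumes G: "decision_diagram G" "reduced G"
    and "u \<in> nodes G" "v \<in> nodes G" "unfolds (content G) u t" "unfolds (content G) v t"
  shows "u = v"
  using assms(3-)
proof (induction t arbitrary: u v)
  case (Leaf b)
  then have "content G u = Sink b" "content G v = Sink b" by (auto elim: unfolds_LeafE)
  then show ?case using G(2) Leaf(1,2) unfolding reduced_def by blast
next
  case (Branch x lo hi)
  obtain l h l' h' where
    u: "content G u = Decision x l h" "unfolds (content G) l lo" "unfolds (content G) h hi" and
    v: "content G v = Decision x l' h'" "unfolds (content G) l' lo" "unfolds (content G) h' hi"
    using Branch.prems(3,4) by (auto elim!: unfolds_BranchE)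
  have "l \<in> nodes G" "h \<in> nodes G" "l' \<in> nodes G" "h' \<in> nodes G"
    using children_in_nodes[OF G(1) Branch.prems(1) u(1)]
      children_in_nodes[OF G(1) Branch.prems(2) v(1)] .
  then have "l = l'" "h = h'" using Branch.IH(1)[of l l'] Branch.IH(2)[of h h'] u v by blast+
  then have "content G v = Decision x l h" using v(1) by simp
  then show ?case using u(1) Branch.prems(1,2) G(2) unfolding reduced_def by blast
qed

text \<open>A path from the root of \<open>G\<close> to \<open>u\<close> can be followed in
  \<open>H\<close> step by step, because the two current nodes always have the same tree.
  Reachability of every node is essential here.\<close>

lemma matching_node:
  assumes G: "decision_diagram G" and H: "decision_diagram H"
    and "unfolds (content G) (root G) t" "unfolds (content H) (root H) t" and u: "u \<in> nodes G"
  shows "\<exists>v\<in>nodes H. \<exists>s. unfolds (content G) u s \<and> unfolds (content H) v s"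
proof -
  have "(root G, u) \<in> (edges G)\<^sup>*" using decision_diagramD(4)[OF G u] .
  then show ?thesis
  proof (induction rule: rtrancl_induct)
    case base
    show ?case using assms(3,4) decision_diagramD(2)[OF H] by blast
  next
    case (step u u')
    then obtain v s where v: "v \<in> nodes H" "unfolds (content G) u s" "unfolds (content H) v s"
      by blast
    from v(2) show ?case
    proof (cases rule: unfolds.cases)
      case (unfolds_Sink b)
      then show ?thesis using edgesD(3)[OF G step(2)] by simp
    next
      case (unfolds_Decision x l h lo hi)
      have "unfolds (content H) v (Branch x lo hi)" using v(3) unfolds_Decision(1) by simp
      then obtain l' h' where v': "content H v = Decision x l' h'"
        "unfolds (content H) l' lo" "unfolds (content H) h' hi"
        by (rule unfolds_BranchE)
      have "u' = l \<or> u' = h" using edgesD(3)[OF G step(2)] unfolds_Decision(2) by simp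
      then show ?thesis
        using v'(2,3) unfolds_Decision(3,4) children_in_nodes[OF H v(1) v'(1)] by blast
    qed
  qed
qed

text \<open>The isomorphism sends a node to the node with the same tree. Injectivity of unfolding in
  both diagrams makes this relation one-to-one; matching nodes in both directions makes it total and
  onto.\<close>

lemma isomorphic_if_same_unfolding:
  assumes G: "decision_diagram G" "reduced G" and H: "decision_diagram H" "reduced H"
    and t: "unfolds (content G) (root G) t" "unfolds (content H) (root H) t"
  shows "isomorphic G H"
proof -
  define R where "R u v \<longleftrightarrow> u \<in> nodes G \<and> v \<in> nodes H \<and>
    (\<exists>s. unfolds (content G) u s \<and> unfolds (content H) v s)" for u v
  have right_unique: "v = v'" if "R u v" "R u v'" for u v v'
    using that unfolds_injective[OF H] unfolds_deterministic unfolding R_def by metis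
  have left_unique: "u = u'" if "R u v" "R u' v" for u u' v
    using that unfolds_injective[OF G] unfolds_deterministic unfolding R_def by metis
  define f where "f u = (THE v. R u v)" for u
  have f_eq: "f u = v" if "R u v" for u v
    unfolding f_def using that right_unique by blast
  have f: "R u (f u)" if "u \<in> nodes G" for u
    using matching_node[OF G(1) H(1) t that] that f_eq unfolding R_def by metis
  have "bij_betw f (nodes G) (nodes H)"
  proof (rule bij_betwI')
    fix u u' assume "u \<in> nodes G" "u' \<in> nodes G"
    then show "f u = f u' \<longleftrightarrow> u = u'" using f left_unique by metis
  next
    fix u assume "u \<in> nodes G"
    then show "f u \<in> nodes H" using f R_def by blast
  next
    fix v assume "v \<in> nodes H"
    then obtain u where "R u v"
      using matching_node[OF H(1) G(1) t(2,1)] unfolding R_def by blast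
    then show "\<exists>u\<in>nodes G. v = f u" using f_eq R_def by blast
  qed
  moreover have "f (root G) = root H"
    by (rule f_eq) (use decision_diagramD(2)[OF G(1)] decision_diagramD(2)[OF H(1)] t R_def in blast)
  moreover have "content H (f u) = map_node f (content G u)" if u: "u \<in> nodes G" for u
  proof -
    obtain s where s: "unfolds (content G) u s" "unfolds (content H) (f u) s"
      using f[OF u] R_def by blast
    from s(1) show ?thesis
    proof (cases rule: unfolds.cases)
      case (unfolds_Sink b)
      then show ?thesis using s(2) by (auto elim: unfolds_LeafE)
    next
      case (unfolds_Decision x l h lo hi)
      then obtain l' h' where v: "content H (f u) = Decision x l' h'"
        "unfolds (content H) l' lo" "unfolds (content H) h' hi"
        using s(2) by (auto elim: unfolds_BranchE)
      have "l' \<in> nodes H" "h' \<in> nodes H" "l \<in> nodes G" "h \<in> nodes G"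
        using children_in_nodes[OF H(1) _ v(1)] children_in_nodes[OF G(1) u unfolds_Decision(2)]
          f[OF u] by (simp_all add: R_def)
      then have "R l l'" "R h h'"
        using v(2,3) unfolds_Decision(3,4) unfolding R_def by blast+
      then have "f l = l'" "f h = h'" by (simp_all add: f_eq)
      then show ?thesis using v unfolds_Decision by simp
    qed
  qed
  ultimately show ?thesis unfolding isomorphic_def by (intro exI[of _ f]) simp
qed

section \<open>Order along paths and order in the tree\<close>

lemma path_labels_simps [simp]:
  "path_labels G [] = []"
  "path_labels G (u # p) = node_labels (content G u) @ path_labels G p"
  "path_labels G (p @ q) = path_labels G p @ path_labels G q"
  by (simp_all add: path_labels_def)

text \<open>The inclusion in \<open>labels t\<close> strengthens the induction: it puts all later
  labels on the path above the label of its first node. The path may stop anywhere, so its tails are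
  covered as well.\<close>

lemma path_labels_sorted:
  assumes "unfolds (content G) u t" "robdd r t"
    and "p \<noteq> []" "hd p = u" "successively (\<lambda>u v. (u, v) \<in> edges G) p"
  shows "set (path_labels G p) \<subseteq> labels t \<and>
    sorted_wrt (\<lambda>x y. (x, y) \<in> r \<and> x \<noteq> y) (path_labels G p)"
  using assms
proof (induction p arbitrary: u t)
  case (Cons w p)
  have w: "w = u" using Cons.prems(4) by simp
  have p: "successively (\<lambda>u v. (u, v) \<in> edges G) p" "p = [] \<or> (u, hd p) \<in> edges G"
    using Cons.prems(5) w by (auto simp: successively_Cons)
  from Cons.prems(1) show ?case
  proof (cases rule: unfolds.cases)
    case (unfolds_Sink b)
    then have "p = []" using p(2) by (auto simp: edges_def)
    then show ?thesis using unfolds_Sink w by simp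
  next
    case (unfolds_Decision x l h lo hi)
    note robdd = Cons.prems(2)[unfolded unfolds_Decision(1)]
    show ?thesis
    proof (cases "p = []")
      case True
      then show ?thesis using unfolds_Decision(1,2) w by simp
    next
      case False
      then have "hd p \<in> {l, h}" using p(2) unfolds_Decision(2) by (simp add: edges_def)
      then obtain s where s: "unfolds (content G) (hd p) s" "s \<in> {lo, hi}"
        using unfolds_Decision(3,4) by blast
      have "robdd r s" using s(2) robdd by auto
      then have "set (path_labels G p) \<subseteq> labels s \<and>
          sorted_wrt (\<lambda>x y. (x, y) \<in> r \<and> x \<noteq> y) (path_labels G p)"
        using Cons.IH[OF s(1)] False p(1) by blast
      moreover have "labels s \<subseteq> labels lo \<union> labels hi" using s(2) by blast
      moreover have "\<forall>y\<in>labels lo \<union> labels hi. (x, y) \<in> r \<and> x \<noteq> y" using robdd by simp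
      moreover have "path_labels G (w # p) = x # path_labels G p" using unfolds_Decision(2) w by simp
      moreover have "labels t = insert x (labels lo \<union> labels hi)" using unfolds_Decision(1) by simp
      ultimately show ?thesis by auto
    qed
  qed
qed simp

text \<open>The strict order along paths excludes repeated labels. Identical children need no
  separate treatment: they would unfold to identical subtrees, which \<open>robdd\<close> rules
  out.\<close>

lemma reduced_obddI:
  assumes G: "decision_diagram G" and r: "linear_order r" "robdd r t"
    and t: "unfolds (content G) (root G) t"
    and sinks: "\<And>u v b. u \<in> nodes G \<Longrightarrow> v \<in> nodes G \<Longrightarrow> content G u = Sink b \<Longrightarrow>
      content G v = Sink b \<Longrightarrow> u = v"
    and decisions: "\<And>u v x l h. u \<in> nodes G \<Longrightarrow> v \<in> nodes G \<Longrightarrow>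
      content G u = Decision x l h \<Longrightarrow> content G v = Decision x l h \<Longrightarrow> u = v"
  shows "reduced_obdd G"
proof -
  have sorted: "sorted_wrt (\<lambda>x y. (x, y) \<in> r \<and> x \<noteq> y) (path_labels G p)"
    if "root_sink_path G p" for p
    using that path_labels_sorted[OF t r(2), of p] by (auto simp: root_sink_path_def)
  have "distinct (path_labels G p)" if "root_sink_path G p" for p
    using sorted[OF that] unfolding distinct_conv_nth sorted_wrt_iff_nth_less
    by (metis linorder_neqE_nat)
  then have "obdd G" using G sorted r(1) by (auto simp: obdd_def fbdd_def)
  moreover have robdd: "\<exists>s. unfolds (content G) u s \<and> robdd r s" if "u \<in> nodes G" for u
  proof -
    have "(root G, u) \<in> (edges G)\<^sup>*" using decision_diagramD(4)[OF G that] .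
    then show ?thesis
    proof (induction rule: rtrancl_induct)
      case base
      show ?case using t r by blast
    next
      case (step u u')
      then obtain s where s: "unfolds (content G) u s" "robdd r s" by blast
      from s(1) show ?case
        by (cases rule: unfolds.cases) (use s(2) edgesD(3)[OF G step(2)] in auto)
    qed
  qed
  have "l \<noteq> h" if u: "u \<in> nodes G" "content G u = Decision x l h" for u x l h
  proof -
    obtain s where s: "unfolds (content G) u s" "robdd r s" using robdd u by blast
    from s(1) obtain lo hi
      where "s = Branch x lo hi" "unfolds (content G) l lo" "unfolds (content G) h hi"
      by (cases rule: unfolds.cases) (simp_all add: u(2))
    then show ?thesis using s(2) unfolds_deterministic[of "content G" l lo hi] by auto
  qed
  then have "reduced G" using sinks decisions unfolding reduced_def by blast
  ultimately show ?thesis by (simp add: reduced_obdd_def)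
qed

text \<open>The order condition of an OBDD speaks only of paths that end in a sink, so a label below
  \<open>v\<close> must be exhibited on such a path. The first conjunct completes the path when the
  label is that of the node itself.\<close>

lemma unfolds_sink_paths:
  assumes G: "decision_diagram G" and "unfolds (content G) v t" "v \<in> nodes G"
  defines "sink_path \<equiv> \<lambda>v q. q \<noteq> [] \<and> hd q = v \<and>
    successively (\<lambda>u v. (u, v) \<in> edges G) q \<and> (\<exists>b. content G (last q) = Sink b)"
  shows "(\<exists>q. sink_path v q) \<and> (\<forall>y\<in>labels t. \<exists>q. sink_path v q \<and> y \<in> set (path_labels G q))"
  using assms(2,3)
proof (induction rule: unfolds.induct)
  case (unfolds_Sink u b)
  then show ?case by (auto simp: sink_path_def intro!: exI[of _ "[u]"])
next
  case (unfolds_Decision u x l h lo hi)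
  have nodes: "l \<in> nodes G" "h \<in> nodes G"
    using children_in_nodes[OF G unfolds_Decision.prems unfolds_Decision.hyps(1)] .
  have extend: "sink_path u (u # q) \<and> set (path_labels G (u # q)) = insert x (set (path_labels G q))"
    if "sink_path w q" "w \<in> {l, h}" for w q
    using that unfolds_Decision
    by (cases q) (auto simp: sink_path_def edges_def)
  obtain q where q: "sink_path u q" "x \<in> set (path_labels G q)"
    using extend unfolds_Decision.IH(1)[OF nodes(1)] by blast
  have "\<exists>q. sink_path u q \<and> y \<in> set (path_labels G q)" if y: "y \<in> labels (Branch x lo hi)" for y
  proof -
    consider "y = x" | "y \<in> labels lo" | "y \<in> labels hi" using y by auto
    then show ?thesis
    proof cases
      case 1
      then show ?thesis using q by blast
    next
      case 2
      then obtain p where "sink_path l p" "y \<in> set (path_labels G p)"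
        using unfolds_Decision.IH(1)[OF nodes(1)] by blast
      then show ?thesis using extend[of l p] by blast
    next
      case 3
      then obtain p where "sink_path h p" "y \<in> set (path_labels G p)"
        using unfolds_Decision.IH(2)[OF nodes(2)] by blast
      then show ?thesis using extend[of h p] by blast
    qed
  qed
  then show ?case using q by blast
qed

lemma rtrancl_successively:
  assumes "(u, v) \<in> E\<^sup>*"
  shows "\<exists>p. p \<noteq> [] \<and> hd p = u \<and> last p = v \<and> successively (\<lambda>u v. (u, v) \<in> E) p"
  using assms
proof (induction rule: rtrancl_induct)
  case base
  show ?case by (rule exI[of _ "[u]"]) simp
next
  case (step v w)
  then obtain p where "p \<noteq> []" "hd p = u" "last p = v" "successively (\<lambda>u v. (u, v) \<in> E) p"
    by blast
  then show ?case using step(2)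
    by (intro exI[of _ "p @ [w]"]) (auto simp: successively_append_iff)
qed

lemma robdd_unfolding:
  assumes G: "reduced_obdd G"
  obtains r t where "linear_order r" "robdd r t" "unfolds (content G) (root G) t"
proof -
  have dd: "decision_diagram G" and red: "reduced G"
    using G by (auto simp: reduced_obdd_def obdd_def fbdd_def)
  obtain r where r: "linear_order r" and sorted: "\<And>p. root_sink_path G p \<Longrightarrow>
      sorted_wrt (\<lambda>x y. (x, y) \<in> r \<and> x \<noteq> y) (path_labels G p)"
    using G by (auto simp: reduced_obdd_def obdd_def)
  \<comment> \<open>A path from the root to \<open>u\<close>, continued from \<open>v\<close>
    through a node labeled \<open>y\<close> down to a sink, lists \<open>x\<close> before
    \<open>y\<close>.\<close>
  have below: "(x, y) \<in> r \<and> x \<noteq> y"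
    if u: "u \<in> nodes G" "x \<in> set (node_labels (content G u))" "(u, v) \<in> edges G"
      and v: "unfolds (content G) v s" "y \<in> labels s" for u v x y s
  proof -
    have "(root G, u) \<in> (edges G)\<^sup>*" using decision_diagramD(4)[OF dd u(1)] .
    then obtain p where p: "p \<noteq> []" "hd p = root G" "last p = u"
      "successively (\<lambda>u v. (u, v) \<in> edges G) p"
      using rtrancl_successively by metis
    obtain q where q: "q \<noteq> []" "hd q = v" "successively (\<lambda>u v. (u, v) \<in> edges G) q"
      "\<exists>b. content G (last q) = Sink b" "y \<in> set (path_labels G q)"
      using unfolds_sink_paths[OF dd v(1) edgesD(2)[OF dd u(3)]] v(2) by blast
    have "root_sink_path G (p @ q)"
      using p q u(3) by (auto simp: root_sink_path_def successively_append_iff)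
    moreover have "x \<in> set (path_labels G p)"
      using p(1,3) u(2) by (auto simp: path_labels_def intro!: bexI[of _ u])
    ultimately show ?thesis
      using sorted[of "p @ q"] q(5) by (auto simp: sorted_wrt_append)
  qed
  have "robdd r s" if "unfolds (content G) u s" "u \<in> nodes G" for u s
    using that
  proof (induction rule: unfolds.induct)
    case (unfolds_Decision u x l h lo hi)
    have nodes: "l \<in> nodes G" "h \<in> nodes G" 
      using children_in_nodes[OF dd unfolds_Decision.prems unfolds_Decision.hyps(1)] .
    have e: "(u, l) \<in> edges G" "(u, h) \<in> edges G"
      using unfolds_Decision(1,6) by (auto simp: edges_def)
    have "l \<noteq> h" using unfolds_Decision(1,6) red by (auto simp: reduced_def)
    \<comment> \<open>Different child nodes have different trees because the diagram is
      reduced.\<close>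
    then have "lo \<noteq> hi" using unfolds_injective[OF dd red nodes] unfolds_Decision(2,3) by blast
    moreover have "x \<in> set (node_labels (content G u))" using unfolds_Decision.hyps(1) by simp
    then have "\<forall>y\<in>labels lo \<union> labels hi. (x, y) \<in> r \<and> x \<noteq> y"
      using below[OF unfolds_Decision.prems _ e(1) unfolds_Decision.hyps(2)]
        below[OF unfolds_Decision.prems _ e(2) unfolds_Decision.hyps(3)] by blast
    ultimately show ?case using unfolds_Decision nodes by simp
  qed simp
  moreover have root: "root G \<in> nodes G" using decision_diagramD(2)[OF dd] .
  moreover obtain t where "unfolds (content G) (root G) t"
    using unfolds_exists[OF dd root] by blast
  ultimately show ?thesis using that r by blast
qed


section \<open>Trees denoted by table references\<close>

text \<open>The bound \<open>i < length T\<close> distinguishes this from unfolding along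
  \<open>ref_content T\<close>: past the end of the table \<open>T ! i\<close> has no useful value,
  and only guarded references keep their tree when the table grows.\<close>

inductive denotes :: "unique_table \<Rightarrow> node_ref \<Rightarrow> variable bdd \<Rightarrow> bool" for T where
  denotes_Sink: "denotes T (Sink_ref b) (Leaf b)"
| denotes_Entry: "i < length T \<Longrightarrow> T ! i = (x, l, h) \<Longrightarrow> denotes T l lo \<Longrightarrow> denotes T h hi \<Longrightarrow>
    denotes T (Entry i) (Branch x lo hi)"

inductive_cases denotes_LeafE: "denotes T u (Leaf b)"
inductive_cases denotes_BranchE: "denotes T u (Branch x lo hi)"

lemma denotes_append: "denotes T u t \<Longrightarrow> denotes (T @ U) u t"
proof (induction rule: denotes.induct)
  case (denotes_Entry i x l h lo hi)
  then show ?case by (intro denotes.denotes_Entry[of i _ x l h]) (auto simp: nth_append)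
qed (rule denotes_Sink)

lemma denotes_unfolds: "denotes T u t \<Longrightarrow> unfolds (ref_content T) u t"
proof (induction rule: denotes.induct)
  case (denotes_Sink b)
  show ?case by (rule unfolds_Sink) simp
next
  case (denotes_Entry i x l h lo hi)
  then show ?case by (intro unfolds_Decision[of _ "Entry i" x l h]) simp_all
qed

lemma denotes_deterministic: "denotes T u t \<Longrightarrow> denotes T u t' \<Longrightarrow> t = t'"
  by (rule unfolds_deterministic[OF denotes_unfolds denotes_unfolds])

text \<open>The analogue of merging for the entire table, reachable or not. It lets the identity
  test in \<open>get_node\<close> decide equality of trees.\<close>

lemma denotes_injective:
  assumes "distinct T" "denotes T u t" "denotes T v t"
  shows "u = v"
  using assms(2,3)
proof (induction t arbitrary: u v rule: bdd.induct)
  case (Leaf b)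
  then show ?case by (auto elim!: denotes_LeafE)
next
  case (Branch x lo hi)
  from Branch.prems(1) obtain i l h where i: "u = Entry i" "i < length T" "T ! i = (x, l, h)"
    "denotes T l lo" "denotes T h hi" by (rule denotes_BranchE)
  from Branch.prems(2) obtain j l' h' where j: "v = Entry j" "j < length T" "T ! j = (x, l', h')"
    "denotes T l' lo" "denotes T h' hi" by (rule denotes_BranchE)
  have "l = l'" "h = h'" using Branch.IH(1)[of l l'] Branch.IH(2)[of h h'] i j by simp_all
  then have "T ! i = T ! j" using i(3) j(3) by simp
  then show ?case using i(1,2) j(1,2) nth_eq_iff_index_eq[OF assms(1)] by blast
qed

lemma reachable_diagram_reduced_obdd:
  assumes T: "distinct T" and t: "denotes T u t" and r: "linear_order r" "robdd r t"
  shows "reduced_obdd (reachable_diagram T u)"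
proof -
  let ?G = "reachable_diagram T u"
  let ?E = "{(u, v). v \<in> children (ref_content T u)}"
  have sel [simp]: "nodes ?G = {v. (u, v) \<in> ?E\<^sup>*}" "root ?G = u" "content ?G = ref_content T"
    by (simp_all add: reachable_diagram_def)
  have den: "\<exists>s. denotes T v s" if "(u, v) \<in> ?E\<^sup>*" for v
    using that
  proof (induction rule: rtrancl_induct)
    case base
    show ?case using t by blast
  next
    case (step v w)
    then obtain s where "denotes T v s" by blast
    then show ?case using step(2) by (cases rule: denotes.cases) auto
  qed
  \<comment> \<open>This gives finiteness of the node set and the index bounds under which
    distinctness of \<open>T\<close> separates entries.\<close>
  have valid: "v \<in> range Sink_ref \<union> Entry ` {..<length T}" if v: "v \<in> nodes ?G" for v
  proof -
    obtain s where "denotes T v s" using den v unfolding sel by blast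
    then show ?thesis by (cases rule: denotes.cases) simp_all
  qed
  have edges: "edges ?G \<subseteq> ?E" by (auto simp: edges_def)
  \<comment> \<open>\<open>edges\<close> keeps only pairs that start in the node set; a path from
    \<open>u\<close> never leaves that set, so nothing is lost.\<close>
  have reach: "(u, v) \<in> (edges ?G)\<^sup>*" if "(u, v) \<in> ?E\<^sup>*" for v
    using that
  proof (induction rule: rtrancl_induct)
    case (step v w)
    then have "(v, w) \<in> edges ?G" by (auto simp: edges_def)
    then show ?case using step by simp
  qed simp
  \<comment> \<open>The rank is the tree size; \<open>THE\<close> is harmless because every
    reachable reference has exactly one tree.\<close>
  define m where "m v = size (THE s. unfolds (ref_content T) v s)" for v
  have m: "m v = size s" if "unfolds (ref_content T) v s" for v s
    using the_equality[of "unfolds (ref_content T) v" s, OF that] unfolds_deterministic[OF _ that]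
    unfolding m_def by simp
  have "edges ?G \<subseteq> (measure m)\<inverse>"
  proof (rule subrelI)
    fix v w assume vw: "(v, w) \<in> edges ?G"
    then have "v \<in> nodes ?G" "w \<in> children (ref_content T v)" by (simp_all add: edges_def)
    then obtain s where "denotes T v s" using den unfolding sel by blast
    then have s: "unfolds (ref_content T) v s" by (rule denotes_unfolds)
    obtain s' where "unfolds (ref_content T) w s'" "size s' < size s"
      using unfolds_children[OF s \<open>w \<in> children (ref_content T v)\<close>] .
    then show "(v, w) \<in> (measure m)\<inverse>" using m s by simp
  qed
  then have "acyclic (edges ?G)"
    by (rule acyclic_subset[rotated]) (simp only: acyclic_converse wf_acyclic wf_measure)
  moreover have "finite (nodes ?G)"
  proof (rule finite_subset)
    show "nodes ?G \<subseteq> range Sink_ref \<union> Entry ` {..<length T}" using valid by blast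
  qed simp
  moreover have "children (content ?G v) \<subseteq> nodes ?G" if "v \<in> nodes ?G" for v
  proof
    fix w assume "w \<in> children (content ?G v)"
    then have "(v, w) \<in> ?E" by simp
    then show "w \<in> nodes ?G" using that rtrancl_into_rtrancl[of u v ?E w] by simp
  qed
  ultimately have "decision_diagram ?G"
    unfolding decision_diagram_def using reach by simp
  then show ?thesis
  proof (rule reduced_obddI[OF _ r])
    show "unfolds (content ?G) (root ?G) t" using denotes_unfolds[OF t] by simp
  next
    fix v w b assume "v \<in> nodes ?G" "w \<in> nodes ?G" "content ?G v = Sink b" "content ?G w = Sink b"
    then show "v = w" by (cases v; cases w) (auto split: prod.splits)
  next
    fix v w x l h assume "v \<in> nodes ?G" "w \<in> nodes ?G"
      and c: "content ?G v = Decision x l h" "content ?G w = Decision x l h"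
    then have "v \<in> range Sink_ref \<union> Entry ` {..<length T}"
      "w \<in> range Sink_ref \<union> Entry ` {..<length T}"
      using valid by blast+
    with c obtain i j where "v = Entry i" "i < length T" "w = Entry j" "j < length T" by auto
    moreover from this c have "T ! i = T ! j" by (auto split: prod.splits)
    ultimately show "v = w" using T by (simp add: nth_eq_iff_index_eq)
  qed
qed


section \<open>Correctness of the algorithm\<close>

definition position :: "'a list \<Rightarrow> 'a \<Rightarrow> nat" where
  "position \<pi> x = length (takeWhile (\<lambda>y. y \<noteq> x) \<pi>)"

text \<open>All variables outside the list have position \<open>length \<pi>\<close>; comparing their numbers makes
  the order total.\<close>

definition list_order :: "variable list \<Rightarrow> variable rel" where
  "list_order \<pi> = {(x, y). position \<pi> x < position \<pi> y \<or> position \<pi> x = position \<pi> y \<and> x \<le> y}"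

lemma position_Cons: "position (z # \<pi>) x = (if x = z then 0 else Suc (position \<pi> x))"
  by (simp add: position_def)

lemma linear_order_list_order: "linear_order (list_order \<pi>)"
  unfolding linear_order_on_def partial_order_on_def preorder_on_def
  by (auto simp: list_order_def refl_on_def total_on_def intro!: transI antisymI)

text \<open>Here \<open>y\<close> may even be missing from \<pi>: its position is then
  \<open>length \<pi>\<close>, beyond that of \<open>x\<close>.\<close>

lemma find_first_list_order:
  assumes "find P \<pi> = Some x" "P y"
  shows "(x, y) \<in> list_order \<pi>"
proof -
  have "x = y \<or> position \<pi> x < position \<pi> y"
    using assms by (induction \<pi>) (auto simp: position_Cons split: if_splits)
  then show ?thesis by (auto simp: list_order_def)
qed

lemma cnf_holds_cond: "cnf_holds \<tau> (cond x b \<Delta>) \<longleftrightarrow> cnf_holds (\<tau>(x := b)) \<Delta>"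
proof -
  \<comment> \<open>The two disjuncts mirror conditioning: a clause with the satisfied literal
    disappears, and the falsified literal is deleted from the others.\<close>
  have lit: "literal_holds (\<tau>(x := b)) l \<longleftrightarrow>
      l = literal_of x b \<or> l \<noteq> literal_of x (\<not> b) \<and> literal_holds \<tau> l" for l
    by (cases l) (auto simp: literal_of_def)
  show ?thesis unfolding cnf_holds_def lit
    by (auto simp: cond_def; metis)
qed

lemma cnf_holds_cong:
  "(\<And>x. x \<in> vars \<Delta> \<Longrightarrow> \<tau> x = \<tau>' x) \<Longrightarrow> cnf_holds \<tau> \<Delta> = cnf_holds \<tau>' \<Delta>"
proof -
  assume eq: "\<And>x. x \<in> vars \<Delta> \<Longrightarrow> \<tau> x = \<tau>' x"
  have "literal_holds \<tau> l = literal_holds \<tau>' l" if "C |\<in>| \<Delta>" "l |\<in>| C" for C l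
    using eq[of "var l"] that by (cases l) (force simp: vars_def)+
  then show ?thesis unfolding cnf_holds_def by blast
qed

text \<open>The formula enters only through its truth function, so the relation is invariant under
  logical equivalence, which is all that a valid key guarantees.\<close>

definition represents :: "variable rel \<Rightarrow> variable bdd \<Rightarrow> cnf \<Rightarrow> bool" where
  "represents r t \<Delta> \<longleftrightarrow> robdd r t \<and> (\<forall>\<tau>. eval_bdd \<tau> t \<longleftrightarrow> cnf_holds \<tau> \<Delta>)"

text \<open>Every label influences the value of the tree, whereas a formula cannot depend on a
  variable that it does not contain.\<close>

lemma represents_labels:
  assumes "linear_order r" "represents r t \<Delta>"
  shows "labels t \<subseteq> vars \<Delta>"
proof
  fix x assume x: "x \<in> labels t"
  have t: "robdd r t" "\<And>\<tau>. eval_bdd \<tau> t \<longleftrightarrow> cnf_holds \<tau> \<Delta>"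
    using assms(2) by (simp_all add: represents_def)
  obtain \<tau> where "cnf_holds (\<tau>(x := True)) \<Delta> \<noteq> cnf_holds (\<tau>(x := False)) \<Delta>"
    using robdd_label_essential[OF assms(1) t(1) x] unfolding t(2) by blast
  moreover have "cnf_holds (\<tau>(x := True)) \<Delta> = cnf_holds (\<tau>(x := False)) \<Delta>" if "x \<notin> vars \<Delta>"
    by (rule cnf_holds_cong) (use that in auto)
  ultimately show "x \<in> vars \<Delta>" by blast
qed

section \<open>The invariant of cache and table\<close>

declare dpll.simps [simp del]

text \<open>The quantifier covers every formula with the given key, not just the one for which the
  entry was made; a cache hit is then correct by definition.\<close>

definition sound_cache :: "(cnf \<Rightarrow> 'k) \<Rightarrow> variable rel \<Rightarrow> 'k cache \<Rightarrow> unique_table \<Rightarrow> bool" where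
  "sound_cache key r cache T \<longleftrightarrow>
    (\<forall>\<Delta> u. cache (key \<Delta>) = Some u \<longrightarrow> (\<exists>t. denotes T u t \<and> represents r t \<Delta>))"

lemma sound_cache_append: "sound_cache key r cache T \<Longrightarrow> sound_cache key r cache (T @ U)"
  unfolding sound_cache_def by (blast intro: denotes_append[of T _ _ U])

text \<open>The three outcomes of \<open>get_node\<close> reduce to two on trees:
  \<open>low = high\<close> holds exactly when \<open>lo = hi\<close>, by determinism and
  injectivity of \<open>denotes\<close>, and a found entry has the same tree as a new one.\<close>

lemma get_node_denotes:
  assumes T: "distinct T" and low: "denotes T low lo" and high: "denotes T high hi"
    and get: "get_node x low high T = (u, T')"
  shows "distinct T' \<and> (\<exists>U. T' = T @ U) \<and> denotes T' u (if lo = hi then lo else Branch x lo hi)"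
proof (cases "low = high")
  case True
  then have "lo = hi" using low high by (intro denotes_deterministic[of T low]) simp_all
  then show ?thesis using True T low get by (simp add: get_node_def)
next
  case False
  then have ne: "lo \<noteq> hi" using denotes_injective[OF T] low high by blast
  show ?thesis
  proof (cases "(x, low, high) \<in> set T")
    case True
    define i where "i = (LEAST i. i < length T \<and> T ! i = (x, low, high))"
    have "\<exists>j. j < length T \<and> T ! j = (x, low, high)" using True by (simp add: in_set_conv_nth)
    then have "i < length T \<and> T ! i = (x, low, high)" unfolding i_def by (rule LeastI_ex)
    then have "denotes T (Entry i) (Branch x lo hi)"
      using denotes_Entry[of i T x low high, OF _ _ low high] by blast
    moreover have "get_node x low high T = (Entry i, T)"
      using False True by (simp add: get_node_def i_def)
    ultimately show ?thesis using get T ne by simp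
  next
    case new: False
    have "denotes (T @ [(x, low, high)]) (Entry (length T)) (Branch x lo hi)"
      by (rule denotes_Entry[of _ _ x low high]) (simp_all add: denotes_append low high)
    moreover have "u = Entry (length T)" "T' = T @ [(x, low, high)]"
      using get False new by (simp_all add: get_node_def)
    ultimately show ?thesis using T new ne by simp
  qed
qed

text \<open>Shannon expansion on \<open>x\<close>. The labels of both cofactors are variables of
  conditioned formulas, hence differ from \<open>x\<close> and come after it.\<close>

lemma represents_combine:
  assumes r: "linear_order r" and low: "represents r lo (cond x False \<Delta>)"
    and high: "represents r hi (cond x True \<Delta>)"
    and first: "\<And>y. y \<in> vars \<Delta> \<Longrightarrow> (x, y) \<in> r"
  shows "represents r (if lo = hi then lo else Branch x lo hi) \<Delta>"
proof -
  have "labels lo \<union> labels hi \<subseteq> vars \<Delta> - {x}"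
    using represents_labels[OF r low] represents_labels[OF r high] vars_cond by fast
  then have "\<forall>y\<in>labels lo \<union> labels hi. (x, y) \<in> r \<and> x \<noteq> y" using first by blast
  moreover have "eval_bdd \<tau> (if lo = hi then lo else Branch x lo hi) \<longleftrightarrow> cnf_holds \<tau> \<Delta>" for \<tau>
  proof -
    \<comment> \<open>Updating \<open>x\<close> to its own value leaves \<tau> unchanged but brings
      the formula into the shape of a conditioned one.\<close>
    have "cnf_holds (\<tau>(x := \<tau> x)) \<Delta> \<longleftrightarrow> eval_bdd \<tau> (if \<tau> x then hi else lo)"
      unfolding cnf_holds_cond[symmetric]
      using low high by (cases "\<tau> x") (simp_all add: represents_def)
    then have "eval_bdd \<tau> (if \<tau> x then hi else lo) \<longleftrightarrow> cnf_holds \<tau> \<Delta>"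
      by (simp only: fun_upd_triv)
    then show ?thesis by (cases "lo = hi"; cases "\<tau> x") simp_all
  qed
  moreover have "robdd r lo" "robdd r hi" using low high by (simp_all add: represents_def)
  ultimately show ?thesis by (cases "lo = hi") (simp_all add: represents_def)
qed

text \<open>The invariant is threaded through both recursive calls. That the table only grows by
  appending is part of the claim, so that references obtained earlier keep their trees; the
  inclusion in \<open>set \<pi>\<close> ensures that a branching variable is found.\<close>

lemma dpll_correct:
  assumes key: "valid_key key"
    and "vars \<Delta> \<subseteq> set \<pi>" "distinct T" "sound_cache key (list_order \<pi>) cache T"
    and "dpll key \<pi> \<Delta> (cache, T) = (u, cache', T')"
  shows "distinct T' \<and> (\<exists>U. T' = T @ U) \<and> sound_cache key (list_order \<pi>) cache' T' \<and>
    (\<exists>t. denotes T' u t \<and> represents (list_order \<pi>) t \<Delta>)"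
  using assms(2-)
proof (induction "card (vars \<Delta>)" arbitrary: \<Delta> cache T u cache' T' rule: less_induct)
  case less
  let ?r = "list_order \<pi>"
  note res = less.prems(4)[unfolded dpll.simps[of key \<pi> \<Delta>]]
  consider (false) "{||} |\<in>| \<Delta>" | (true) "{||} |\<notin>| \<Delta>" "vars \<Delta> = {}"
    | (cached) v where "{||} |\<notin>| \<Delta>" "vars \<Delta> \<noteq> {}" "cache (key \<Delta>) = Some v"
    | (new) "{||} |\<notin>| \<Delta>" "vars \<Delta> \<noteq> {}" "cache (key \<Delta>) = None"
    by (cases "cache (key \<Delta>)") auto
  then show ?case
  proof cases
    case false
    then have "represents ?r (Leaf False) \<Delta>" by (auto simp: represents_def cnf_holds_def)
    then show ?thesis using res false less.prems by (auto intro: denotes_Sink)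
  next
    case true
    then have "fset C = {}" if "C |\<in>| \<Delta>" for C using that by (auto simp: vars_def)
    then have "C = {||}" if "C |\<in>| \<Delta>" for C using that by (simp add: fset_inject[symmetric])
    then have "\<Delta> = {||}" using true(1) by blast
    then have "represents ?r (Leaf True) \<Delta>" by (auto simp: represents_def cnf_holds_def)
    then show ?thesis using res true less.prems by (auto intro: denotes_Sink)
  next
    case cached
    then show ?thesis using res less.prems by (auto simp: sound_cache_def)
  next
    case new
    obtain x where x: "find (\<lambda>x. x \<in> vars \<Delta>) \<pi> = Some x"
      using new(2) less.prems(1) by (cases "find (\<lambda>x. x \<in> vars \<Delta>) \<pi>") (auto simp: find_None_iff)
    then have xv: "x \<in> vars \<Delta>" by (auto simp: find_Some_iff)
    have sub: "vars (cond x b \<Delta>) \<subset> vars \<Delta>" for b using vars_cond xv by blast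
    have smaller: "card (vars (cond x b \<Delta>)) < card (vars \<Delta>)" "vars (cond x b \<Delta>) \<subseteq> set \<pi>" for b
      using psubset_card_mono[OF finite_vars sub] sub[of b] less.prems(1) by auto
    obtain low c0 T0 where low: "dpll key \<pi> (cond x False \<Delta>) (cache, T) = (low, c0, T0)"
      by (metis prod_cases3)
    obtain high c1 T1 where high: "dpll key \<pi> (cond x True \<Delta>) (c0, T0) = (high, c1, T1)"
      by (metis prod_cases3)
    obtain v T2 where get: "get_node x low high T1 = (v, T2)" by fastforce
    have out: "u = v" "cache' = c1(key \<Delta> \<mapsto> v)" "T' = T2"
      using res new x low high get by auto
    obtain U0 lo where L: "distinct T0" "T0 = T @ U0" "sound_cache key ?r c0 T0"
      "denotes T0 low lo" "represents ?r lo (cond x False \<Delta>)"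
      using less.hyps[OF smaller less.prems(2,3) low] by blast
    obtain U1 hi where H: "distinct T1" "T1 = T0 @ U1" "sound_cache key ?r c1 T1"
      "denotes T1 high hi" "represents ?r hi (cond x True \<Delta>)"
      using less.hyps[OF smaller L(1,3) high] by blast
    define t where "t = (if lo = hi then lo else Branch x lo hi)"
    \<comment> \<open>\<open>low\<close> was returned before the second call, which may have
      enlarged the table.\<close>
    have "denotes T1 low lo" using L(4) H(2) denotes_append by blast
    then obtain U2 where N: "distinct T2" "T2 = T1 @ U2" "denotes T2 v t"
      using get_node_denotes[OF H(1) _ H(4) get] t_def by blast
    have rep: "represents ?r t \<Delta>"
      unfolding t_def using linear_order_list_order L(5) H(5) find_first_list_order[OF x]
      by (rule represents_combine)
    \<comment> \<open>The new cache entry also answers for all other formulas with this key, and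
      they are logically equivalent to \<Delta>.\<close>
    have "represents ?r t \<Delta>'" if "key \<Delta>' = key \<Delta>" for \<Delta>'
    proof -
      have "logically_equivalent \<Delta>' \<Delta>" using key that unfolding valid_key_def by blast
      then show ?thesis using rep by (simp add: logically_equivalent_def represents_def)
    qed
    moreover have "sound_cache key ?r c1 T2" using sound_cache_append[OF H(3)] N(2) by simp
    ultimately have "sound_cache key ?r cache' T'"
      using N(3) unfolding out sound_cache_def fun_upd_apply by (metis option.inject)
    moreover have "T' = T @ (U0 @ U1 @ U2)" using out N L(2) H(2) by simp
    ultimately show ?thesis using rep N(1,3) out by blast
  qed
qed

lemma dpll_diagram_unfolding:
  assumes "valid_key key" "variable_order \<pi> \<Delta>"
  obtains t where "represents (list_order \<pi>) t \<Delta>"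
    "unfolds (content (dpll_diagram key \<Delta> \<pi>)) (root (dpll_diagram key \<Delta> \<pi>)) t"
    "reduced_obdd (dpll_diagram key \<Delta> \<pi>)"
proof -
  obtain u cache T where d: "dpll key \<pi> \<Delta> (Map.empty, []) = (u, cache, T)"
    by (metis prod_cases3)
  obtain t where t: "distinct T" "denotes T u t" "represents (list_order \<pi>) t \<Delta>"
    using dpll_correct[OF assms(1) _ _ _ d] assms(2)
    by (auto simp: variable_order_def sound_cache_def)
  have "dpll_diagram key \<Delta> \<pi> = reachable_diagram T u" by (simp add: dpll_diagram_def d)
  then show ?thesis
    using that[of t] t denotes_unfolds[OF t(2)]
      reachable_diagram_reduced_obdd[OF t(1,2) linear_order_list_order[of \<pi>]]
    by (simp add: represents_def reachable_diagram_def)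
qed


section \<open>A formula and a variable order for a given tree\<close>

text \<open>Each path to a false leaf becomes a clause that negates the decisions taken along it. A
  branch is the conjunction of \<open>x\<close> or \<open>l\<close> with not \<open>x\<close> or
  \<open>h\<close>, distributed over the clauses of \<open>l\<close> and \<open>h\<close>.\<close>

fun cnf_of :: "variable bdd \<Rightarrow> cnf" where
  "cnf_of (Leaf b) = (if b then {||} else {|{||}|})"
| "cnf_of (Branch x l h) = finsert (Pos x) |`| cnf_of l |\<union>| finsert (Neg x) |`| cnf_of h"

lemma vars_finsert_image: "vars (finsert l |`| \<Delta>) \<subseteq> insert (var l) (vars \<Delta>)"
  by (auto simp: vars_def)

lemma vars_funion: "vars (\<Delta> |\<union>| \<Delta>') = vars \<Delta> \<union> vars \<Delta>'"
  by (auto simp: vars_def)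

lemma vars_cnf_of: "vars (cnf_of t) \<subseteq> labels t"
proof (induction t)
  case (Branch x l h)
  then show ?case
    using vars_finsert_image[of "Pos x" "cnf_of l"] vars_finsert_image[of "Neg x" "cnf_of h"]
    by (auto simp: vars_funion)
qed (simp add: vars_def)

lemma cnf_holds_finsert_image:
  "cnf_holds \<tau> (finsert l |`| \<Delta>) \<longleftrightarrow> literal_holds \<tau> l \<or> cnf_holds \<tau> \<Delta>"
proof -
  have "cnf_holds \<tau> \<Delta> \<longleftrightarrow> (\<forall>C\<in>fset \<Delta>. \<exists>l\<in>fset C. literal_holds \<tau> l)" for \<Delta>
    by (auto simp: cnf_holds_def)
  then show ?thesis by simp
qed

lemma cnf_holds_funion: "cnf_holds \<tau> (\<Delta> |\<union>| \<Delta>') \<longleftrightarrow> cnf_holds \<tau> \<Delta> \<and> cnf_holds \<tau> \<Delta>'"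
  by (auto simp: cnf_holds_def)

lemma cnf_holds_cnf_of: "cnf_holds \<tau> (cnf_of t) \<longleftrightarrow> eval_bdd \<tau> t"
proof (induction t)
  case (Leaf b)
  show ?case by (simp add: cnf_holds_def)
qed (simp add: cnf_holds_funion cnf_holds_finsert_image)

text \<open>An OBDD is ordered by a relation on all variables, while the algorithm takes a finite
  list; this extracts the list.\<close>

lemma linear_order_enumeration:
  assumes "linear_order r" "finite A"
  shows "\<exists>xs. set xs = A \<and> distinct xs \<and> sorted_wrt (\<lambda>x y. (x, y) \<in> r) xs"
  using assms(2)
proof (induction rule: finite_induct)
  case (insert a A)
  then obtain xs where xs: "set xs = A" "distinct xs" "sorted_wrt (\<lambda>x y. (x, y) \<in> r) xs" by blast
  have po: "trans r" "total r"
    using assms(1) by (auto simp: linear_order_on_def partial_order_on_def preorder_on_def)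
  let ?lower = "\<lambda>x. (x, a) \<in> r"
  \<comment> \<open>Insertion of \<open>a\<close>: by totality \<open>a\<close> precedes everything
    that is not below it, and transitivity orders the two parts.\<close>
  let ?xs = "filter ?lower xs @ a # filter (\<lambda>x. \<not> ?lower x) xs"
  have "(a, y) \<in> r" if "y \<in> A" "(y, a) \<notin> r" for y
    using that insert(2) po(2) unfolding total_on_def by (metis UNIV_I)
  then have "sorted_wrt (\<lambda>x y. (x, y) \<in> r) ?xs"
    using xs po(1) by (auto simp: sorted_wrt_append sorted_wrt_filter dest: transD)
  moreover have "set ?xs = insert a A" "distinct ?xs" using xs insert(2) by auto
  ultimately show ?case by blast
qed simp

lemma sorted_list_order:
  assumes "antisym r" "sorted_wrt (\<lambda>x y. (x, y) \<in> r) \<pi>" "x \<in> set \<pi>" "y \<in> set \<pi>" "(x, y) \<in> r"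
  shows "(x, y) \<in> list_order \<pi>"
proof -
  have "x = y \<or> position \<pi> x < position \<pi> y"
    using assms(2-) by (induction \<pi>) (auto simp: position_Cons dest: antisymD[OF assms(1)])
  then show ?thesis by (auto simp: list_order_def)
qed

text \<open>Only comparisons between labels of the tree matter, so two orders that agree there are
  interchangeable.\<close>

lemma robdd_mono:
  assumes "robdd r t" "\<And>x y. x \<in> labels t \<Longrightarrow> y \<in> labels t \<Longrightarrow> (x, y) \<in> r \<Longrightarrow> (x, y) \<in> r'"
  shows "robdd r' t"
  using assms
proof (induction t)
  case (Branch x l h)
  have "robdd r' l" "robdd r' h" using Branch.IH Branch.prems by simp_all
  then show ?case using Branch.prems by simp
qed simp

theorem theorem2:
  fixes key :: "cnf \<Rightarrow> 'k"
  assumes "valid_key key"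
  shows "(\<forall>\<Delta> \<pi>. variable_order \<pi> \<Delta> \<longrightarrow> reduced_obdd (dpll_diagram key \<Delta> \<pi>)) \<and>
    (\<forall>G :: 'v diagram. reduced_obdd G \<longrightarrow>
      (\<exists>\<Delta> \<pi>. variable_order \<pi> \<Delta> \<and> isomorphic (dpll_diagram key \<Delta> \<pi>) G))"
proof (intro conjI allI impI)
  fix \<Delta> \<pi> assume "variable_order \<pi> \<Delta>"
  then show "reduced_obdd (dpll_diagram key \<Delta> \<pi>)"
    by (rule dpll_diagram_unfolding[OF assms])
next
  fix G :: "'v diagram" assume G: "reduced_obdd G"
  obtain r t where r: "linear_order r" and t: "robdd r t" "unfolds (content G) (root G) t"
    using robdd_unfolding[OF G] .
  obtain \<pi> where \<pi>: "set \<pi> = labels t" "distinct \<pi>" "sorted_wrt (\<lambda>x y. (x, y) \<in> r) \<pi>"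
    using linear_order_enumeration[OF r finite_labels] by blast
  define D where "D = dpll_diagram key (cnf_of t) \<pi>"
  have order: "variable_order \<pi> (cnf_of t)"
    using \<pi> vars_cnf_of by (simp add: variable_order_def)
  obtain s where s: "represents (list_order \<pi>) s (cnf_of t)" "unfolds (content D) (root D) s"
    "reduced_obdd D"
    using dpll_diagram_unfolding[OF assms order] unfolding D_def .
  have "antisym r" using r by (simp add: linear_order_on_def partial_order_on_def)
  \<comment> \<open>The output tree \<open>s\<close> is ordered by \<open>list_order \<pi>\<close>,
    but \<open>t\<close> so far only by \<open>r\<close>; canonicity needs one order for
    both.\<close>
  then have "robdd (list_order \<pi>) t"
    using robdd_mono[OF t(1)] sorted_list_order \<pi> by blast
  then have "s = t"
    using robdd_unique[OF linear_order_list_order] s(1)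
    by (auto simp: represents_def cnf_holds_cnf_of)
  then have "isomorphic D G"
    using isomorphic_if_same_unfolding s t(2) G by (auto simp: reduced_obdd_def obdd_def fbdd_def)
  then show "\<exists>\<Delta> \<pi>. variable_order \<pi> \<Delta> \<and> isomorphic (dpll_diagram key \<Delta> \<pi>) G"
    using order D_def by blast
qed

end
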